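(* For every $n\ge 1$ and $\beta\ge 0$, the stationary expected social welfare of the logit dynamics with inverse noise $\beta$ for the $n$-player OR game is $\mathbf{E}_\pi[W]=-\alpha n$, where $$\alpha=\alpha(n,\beta)=\frac{(2^n-1)e^{-\beta}}{1+(2^n-1)e^{-\beta}}.$$
   Context: OR game: $n$ players, each with strategy set $\{0,1\}$; for every player $i$, $u_i(\mathbf{x})=0$ if $\mathbf{x}=(0,\dots,0)$ and $u_i(\mathbf{x})=-1$ otherwise. Logit dynamics: for a strategic game with $n$ players, finite strategy sets $S_i$ and utilities $u_i:\prod_j S_j\to\mathbb{R}$, and for $\beta\ge 0$, let $\sigma_i(y\mid\mathbf{x})=e^{\beta u_i(\mathbf{x}_{-i},y)}/\sum_{z\in S_i}e^{\beta u_i(\mathbf{x}_{-i},z)}$, where $(\mathbf{x}_{-i},y)$ is $\mathbf{x}$ with its $i$-th entry replaced by $y$. The logit dynamics with inverse noise $\beta$ is the Markov chain on $\Omega=\prod_j S_j$ which, from profile $\mathbf{x}$, selects a player $i$ uniformly at random and replaces $x_i$ by $y\in S_i$ with probability $\sigma_i(y\mid\mathbf{x})$. It is irreducible and aperiodic; $\pi$ denotes its unique stationary distribution. The social welfare is $W(\mathbf{x})=\sum_i u_i(\mathbf{x})$, and $\mathbf{E}_\pi[W]=\sum_{\mathbf{x}}W(\mathbf{x})\pi(\mathbf{x})$. *)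

theory Defs
  imports "HOL-Probability.Probability"
begin

text \<open>Players are \<open>0, \<dots>, n - 1\<close>.  Profiles are extensional functions
  (\<open>undefined\<close> outside the set of players), so that they are in bijection with tuples.\<close>

record 's game =
  num_players :: nat
  strategies :: "nat \<Rightarrow> 's set"
  utility :: "nat \<Rightarrow> (nat \<Rightarrow> 's) \<Rightarrow> real"

definition profiles :: "'s game \<Rightarrow> (nat \<Rightarrow> 's) set" where
  "profiles G = (\<Pi>\<^sub>E i\<in>{..<num_players G}. strategies G i)"

definition social_welfare :: "'s game \<Rightarrow> (nat \<Rightarrow> 's) \<Rightarrow> real" where
  "social_welfare G x = (\<Sum>i<num_players G. utility G i x)"

definition logit_prob :: "'s game \<Rightarrow> real \<Rightarrow> nat \<Rightarrow> (nat \<Rightarrow> 's) \<Rightarrow> 's \<Rightarrow> real" where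
  "logit_prob G \<beta> i x y =
     exp (\<beta> * utility G i (x(i := y))) / (\<Sum>z\<in>strategies G i. exp (\<beta> * utility G i (x(i := z))))"

definition logit_choice :: "'s game \<Rightarrow> real \<Rightarrow> nat \<Rightarrow> (nat \<Rightarrow> 's) \<Rightarrow> 's pmf" where
  "logit_choice G \<beta> i x =
     embed_pmf (\<lambda>y. if y \<in> strategies G i then logit_prob G \<beta> i x y else 0)"

text \<open>\<^const>\<open>embed_pmf\<close> is only meaningful for weights that sum to one; the next lemma
  confirms that this is the case here.\<close>

lemma pmf_logit_choice:
  assumes "finite (strategies G i)" "strategies G i \<noteq> {}"
  shows "pmf (logit_choice G \<beta> i x) y = (if y \<in> strategies G i then logit_prob G \<beta> i x y else 0)"
proof -
  let ?S = "strategies G i"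
  let ?f = "\<lambda>y. if y \<in> ?S then logit_prob G \<beta> i x y else 0"
  let ?Z = "\<Sum>z\<in>?S. exp (\<beta> * utility G i (x(i := z)))"
  have Z: "?Z > 0"
    using assms by (intro sum_pos) auto
  have nonneg: "?f y \<ge> 0" for y
    using Z by (simp add: logit_prob_def)
  have "(\<Sum>y\<in>?S. logit_prob G \<beta> i x y) = 1"
    using Z by (simp add: logit_prob_def flip: sum_divide_distrib)
  moreover have "(\<integral>\<^sup>+y. ennreal (?f y) \<partial>count_space UNIV) = (\<Sum>y\<in>?S. ennreal (?f y))"
    using assms(1) by (intro nn_integral_count_space') auto
  moreover have "(\<Sum>y\<in>?S. ennreal (?f y)) = ennreal (\<Sum>y\<in>?S. ?f y)"
    using nonneg by (intro sum_ennreal)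
  ultimately have "(\<integral>\<^sup>+y. ennreal (?f y) \<partial>count_space UNIV) = 1"
    by simp
  then show ?thesis
    unfolding logit_choice_def using nonneg by (subst pmf_embed_pmf) auto
qed

definition logit_step :: "'s game \<Rightarrow> real \<Rightarrow> (nat \<Rightarrow> 's) \<Rightarrow> (nat \<Rightarrow> 's) pmf" where
  "logit_step G \<beta> x =
     do {
       i \<leftarrow> pmf_of_set {..<num_players G};
       y \<leftarrow> logit_choice G \<beta> i x;
       return_pmf (x(i := y))
     }"

definition stationary_on :: "'a set \<Rightarrow> ('a \<Rightarrow> 'a pmf) \<Rightarrow> 'a pmf \<Rightarrow> bool" where
  "stationary_on \<Omega> K \<pi> \<longleftrightarrow> set_pmf \<pi> \<subseteq> \<Omega> \<and> bind_pmf \<pi> K = \<pi>"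

text \<open>The chain is irreducible on the finite set of profiles (when there is at least one player
  and all strategy sets are finite and nonempty), hence the description below is proper.\<close>

definition logit_stationary :: "'s game \<Rightarrow> real \<Rightarrow> (nat \<Rightarrow> 's) pmf" where
  "logit_stationary G \<beta> = (THE \<pi>. stationary_on (profiles G) (logit_step G \<beta>) \<pi>)"

definition OR_game :: "nat \<Rightarrow> nat game" where
  "OR_game n =
     \<lparr> num_players = n,
       strategies = (\<lambda>_. {0, 1}),
       utility = (\<lambda>_ x. if \<forall>j<n. x j = 0 then 0 else - 1) \<rparr>"

end

theory Submission
  imports Defs
begin

text \<open>The OR game is a potential game, so its Gibbs measure is in detailed balance with every
  single-player update and hence stationary.  The chain is irreducible, so the Gibbs measure is
  its only stationary distribution.  It gives weight \<open>1\<close> to the zero profile and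
  \<open>e\<^bsup>-\<beta>\<^esup>\<close> to each of the other \<open>2\<^sup>n - 1\<close> profiles, up to normalisation.\<close>

section \<open>Stationary distributions of Markov chains on a finite set\<close>

lemma pmf_bind_finite_support:
  assumes "finite A" "set_pmf p \<subseteq> A"
  shows "pmf (bind_pmf p K) y = (\<Sum>x\<in>A. pmf p x * pmf (K x) y)"
  using assms by (simp add: pmf_bind integral_measure_pmf[of A] subset_iff)

lemma stationary_on_pmf:
  assumes "finite \<Omega>" "stationary_on \<Omega> K p"
  shows "pmf p y = (\<Sum>x\<in>\<Omega>. pmf p x * pmf (K x) y)"
  using assms pmf_bind_finite_support[of \<Omega> p K y] by (simp add: stationary_on_def)

text \<open>The support of a stationary distribution is nonempty and closed under transitions of
  positive probability, so irreducibility spreads it over all of \<Omega>.\<close>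

lemma stationary_on_support:
  assumes "stationary_on \<Omega> K p"
    and "\<And>x y. x \<in> \<Omega> \<Longrightarrow> y \<in> \<Omega> \<Longrightarrow> (x, y) \<in> {(x, y). y \<in> set_pmf (K x)}\<^sup>*"
  shows "set_pmf p = \<Omega>"
proof
  show sub: "set_pmf p \<subseteq> \<Omega>"
    using assms(1) by (simp add: stationary_on_def)
  obtain x where x: "x \<in> set_pmf p"
    using set_pmf_not_empty[of p] by blast
  have "y \<in> set_pmf p" if "(x, y) \<in> {(x, y). y \<in> set_pmf (K x)}\<^sup>*" for y
    using that
  proof (induction rule: rtrancl_induct)
    case base
    show ?case by (rule x)
  next
    case (step y z)
    then have "z \<in> set_pmf (bind_pmf p K)"
      by auto
    moreover have "bind_pmf p K = p"
      using assms(1) by (simp add: stationary_on_def)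
    ultimately show ?case
      by (simp only:)
  qed
  with assms(2) sub x show "\<Omega> \<subseteq> set_pmf p"
    by blast
qed

text \<open>Subtract from \<open>p\<close> the largest multiple of \<open>q\<close> that keeps it nonnegative: the difference is
  stationary, and its zero propagates backwards along transitions of positive probability.\<close>

lemma stationary_on_unique:
  assumes fin: "finite \<Omega>" and p: "stationary_on \<Omega> K p" and q: "stationary_on \<Omega> K q"
    and irred: "\<And>x y. x \<in> \<Omega> \<Longrightarrow> y \<in> \<Omega> \<Longrightarrow> (x, y) \<in> {(x, y). y \<in> set_pmf (K x)}\<^sup>*"
  shows "p = q"
proof -
  have supp: "set_pmf p = \<Omega>" "set_pmf q = \<Omega>"
    using stationary_on_support[OF p irred] stationary_on_support[OF q irred] by auto
  have ne: "\<Omega> \<noteq> {}"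
    using supp(1) set_pmf_not_empty by metis
  define c where "c = Min ((\<lambda>x. pmf p x / pmf q x) ` \<Omega>)"
  define d where "d x = pmf p x - c * pmf q x" for x
  have qpos: "pmf q x > 0" if "x \<in> \<Omega>" for x
    using that supp(2) by (simp add: pmf_positive)
  have "c \<le> pmf p x / pmf q x" if "x \<in> \<Omega>" for x
    unfolding c_def using that fin by (intro Min_le) auto
  then have nonneg: "d x \<ge> 0" if "x \<in> \<Omega>" for x
    using that qpos by (simp add: d_def field_simps)
  have "c \<in> (\<lambda>x. pmf p x / pmf q x) ` \<Omega>"
    unfolding c_def using fin ne by (intro Min_in) auto
  then obtain y where y: "y \<in> \<Omega>" "d y = 0"
    using qpos by (force simp: d_def)
  have stat: "d z = (\<Sum>x\<in>\<Omega>. d x * pmf (K x) z)" for z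
    unfolding d_def stationary_on_pmf[OF fin p, of z] stationary_on_pmf[OF fin q, of z]
    by (simp add: left_diff_distrib sum_subtractf sum_distrib_left mult.assoc)
  have "x \<in> \<Omega> \<longrightarrow> d x = 0" if "(x, y) \<in> {(x, y). y \<in> set_pmf (K x)}\<^sup>*" for x
    using that
  proof (induction rule: converse_rtrancl_induct)
    case base
    show ?case using y by simp
  next
    case (step x z)
    show ?case
    proof
      assume x: "x \<in> \<Omega>"
      have z: "z \<in> set_pmf (K x)"
        using step by simp
      \<comment> \<open>That \<open>K\<close> does not leave \<Omega> is not among the hypotheses;
        it follows because \<open>x\<close> carries mass under the stationary \<open>p\<close>,
        whose support is \<Omega>.\<close>
      then have "z \<in> set_pmf (bind_pmf p K)"
        using x supp by auto
      moreover have "bind_pmf p K = p"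
        using p by (simp add: stationary_on_def)
      ultimately have "z \<in> \<Omega>"
        using supp by (simp only:)
      \<comment> \<open>Stationarity writes \<open>d z = 0\<close> as a sum of nonnegative terms, so
        each term vanishes; the one for \<open>x\<close> has the positive factor
        \<open>pmf (K x) z\<close>.\<close>
      with step have "(\<Sum>x\<in>\<Omega>. d x * pmf (K x) z) = 0"
        using stat[of z] by simp
      then have "d x * pmf (K x) z = 0"
        using fin nonneg x by (subst (asm) sum_nonneg_eq_0_iff) auto
      then show "d x = 0"
        using z by (simp add: set_pmf_iff)
    qed
  qed
  then have eq: "pmf p x = c * pmf q x" if "x \<in> \<Omega>" for x
    using irred that y(1) by (simp add: d_def)
  \<comment> \<open>Both distributions have total mass one on \<Omega>, which forces
    \<open>c = 1\<close>.\<close>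
  have "1 = (\<Sum>x\<in>\<Omega>. pmf p x)"
    using fin supp by (simp add: sum_pmf_eq_1)
  also have "\<dots> = c * (\<Sum>x\<in>\<Omega>. pmf q x)"
    using eq by (simp add: sum_distrib_left)
  also have "\<dots> = c"
    using fin supp by (simp add: sum_pmf_eq_1)
  finally show ?thesis
    using eq supp by (intro pmf_eqI) (metis mult_1 set_pmf_iff)
qed

text \<open>Summed over \<open>x\<close>, the balance equations turn the flow into \<open>y\<close>
  into the flow out of \<open>y\<close>, and the latter is \<open>pmf p y\<close> because
  \<open>K y\<close> has all its mass in \<Omega>.\<close>

lemma stationary_on_detailed_balance:
  assumes fin: "finite \<Omega>" and sub: "set_pmf p \<subseteq> \<Omega>"
    and closed: "\<And>x. x \<in> \<Omega> \<Longrightarrow> set_pmf (K x) \<subseteq> \<Omega>"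
    and balance: "\<And>x y. x \<in> \<Omega> \<Longrightarrow> y \<in> \<Omega> \<Longrightarrow> pmf p x * pmf (K x) y = pmf p y * pmf (K y) x"
  shows "stationary_on \<Omega> K p"
  unfolding stationary_on_def
proof (intro conjI sub pmf_eqI)
  fix y
  show "pmf (bind_pmf p K) y = pmf p y"
  proof (cases "y \<in> \<Omega>")
    case True
    have "pmf (bind_pmf p K) y = (\<Sum>x\<in>\<Omega>. pmf p y * pmf (K y) x)"
      unfolding pmf_bind_finite_support[OF fin sub] using balance True by (intro sum.cong) auto
    also have "\<dots> = pmf p y"
      using fin closed[OF True] by (simp add: sum_pmf_eq_1 flip: sum_distrib_left)
    finally show ?thesis .
  next
    case False
    then have "y \<notin> set_pmf (bind_pmf p K)" "y \<notin> set_pmf p"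
      using sub closed by fastforce+
    then show ?thesis
      by (simp only: set_pmf_iff not_not)
  qed
qed

text \<open>The index can be drawn before the state, since independent draws commute. This reduces
  stationarity under a randomly selected player to stationarity under each fixed player.\<close>

lemma stationary_on_mixture:
  assumes "\<And>i. i \<in> set_pmf r \<Longrightarrow> stationary_on \<Omega> (K i) p"
  shows "stationary_on \<Omega> (\<lambda>x. bind_pmf r (\<lambda>i. K i x)) p"
proof -
  have "bind_pmf p (\<lambda>x. bind_pmf r (\<lambda>i. K i x)) = bind_pmf r (\<lambda>i. bind_pmf p (K i))"
    by (rule bind_commute_pmf)
  also have "\<dots> = bind_pmf r (\<lambda>i. p)"
    using assms by (intro bind_pmf_cong) (auto simp: stationary_on_def)
  finally have "bind_pmf p (\<lambda>x. bind_pmf r (\<lambda>i. K i x)) = p"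
    by simp
  moreover have "set_pmf p \<subseteq> \<Omega>"
    using assms set_pmf_not_empty[of r] by (force simp: stationary_on_def)
  ultimately show ?thesis
    by (simp add: stationary_on_def)
qed

section \<open>Logit dynamics of a finite game: transitions and irreducibility\<close>

locale finite_game =
  fixes G :: "'s game" and \<beta> :: real
  assumes players: "num_players G > 0"
    and finite_strategies: "\<And>i. i < num_players G \<Longrightarrow> finite (strategies G i)"
    and strategies_nonempty: "\<And>i. i < num_players G \<Longrightarrow> strategies G i \<noteq> {}"
begin

definition player_step :: "nat \<Rightarrow> (nat \<Rightarrow> 's) \<Rightarrow> (nat \<Rightarrow> 's) pmf" where
  "player_step i x = map_pmf (\<lambda>y. x(i := y)) (logit_choice G \<beta> i x)"

lemma logit_step_eq:
  "logit_step G \<beta> = (\<lambda>x. bind_pmf (pmf_of_set {..<num_players G}) (\<lambda>i. player_step i x))"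
  by (simp add: logit_step_def player_step_def map_pmf_def fun_eq_iff)

lemma finite_profiles: "finite (profiles G)"
  unfolding profiles_def using finite_strategies by (intro finite_PiE) auto

lemma profiles_nonempty: "profiles G \<noteq> {}"
  unfolding profiles_def using strategies_nonempty by (simp add: PiE_eq_empty_iff)

lemma profiles_upd:
  "x \<in> profiles G \<Longrightarrow> i < num_players G \<Longrightarrow> y \<in> strategies G i \<Longrightarrow> x(i := y) \<in> profiles G"
  by (auto simp: profiles_def PiE_iff extensional_def)

lemma set_logit_choice:
  assumes "i < num_players G"
  shows "set_pmf (logit_choice G \<beta> i x) = strategies G i"
proof -
  note fin = finite_strategies[OF assms] strategies_nonempty[OF assms]
  have "(\<Sum>z\<in>strategies G i. exp (\<beta> * utility G i (x(i := z)))) > 0"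
    using fin by (intro sum_pos) auto
  then show ?thesis
    by (auto simp: set_pmf_iff pmf_logit_choice[OF fin] logit_prob_def split: if_splits)
qed

lemma set_player_step:
  "i < num_players G \<Longrightarrow> set_pmf (player_step i x) = (\<lambda>y. x(i := y)) ` strategies G i"
  by (simp add: player_step_def set_logit_choice)

text \<open>The test \<open>z = x(i := z i)\<close> says that \<open>z\<close> and \<open>x\<close>
  agree away from \<open>i\<close>. Distinct strategies give distinct updated profiles, so no masses
  are merged.\<close>

lemma pmf_player_step:
  assumes "i < num_players G" "z i \<in> strategies G i"
  shows "pmf (player_step i x) z = (if z = x(i := z i) then logit_prob G \<beta> i x (z i) else 0)"
proof (cases "z = x(i := z i)")
  case True
  have "pmf (player_step i x) (x(i := z i)) = pmf (logit_choice G \<beta> i x) (z i)"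
    unfolding player_step_def by (rule pmf_map_inj') (simp add: inj_def fun_upd_eqD)
  with True show ?thesis
    using assms finite_strategies strategies_nonempty by (simp add: pmf_logit_choice)
next
  case False
  then have "z \<notin> set_pmf (player_step i x)"
    using assms by (auto simp: set_player_step)
  with False show ?thesis
    by (simp add: set_pmf_iff)
qed

lemma set_logit_step:
  "set_pmf (logit_step G \<beta> x) = (\<Union>i<num_players G. (\<lambda>y. x(i := y)) ` strategies G i)"
  using players by (simp add: logit_step_eq set_player_step set_pmf_of_set lessThan_empty_iff)

text \<open>Logit weights are exponentials, hence positive, so every single-player change is
  possible; changing the players one after another leads from \<open>x\<close> to
  \<open>z\<close>.\<close>

lemma logit_step_irreducible:
  assumes x: "x \<in> profiles G" and z: "z \<in> profiles G"
  shows "(x, z) \<in> {(x, y). y \<in> set_pmf (logit_step G \<beta> x)}\<^sup>*"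
proof -
  let ?R = "{(x, y). y \<in> set_pmf (logit_step G \<beta> x)}"
  \<comment> \<open>The intermediate profile in which the first \<open>k\<close> players have
    already moved to \<open>z\<close>.\<close>
  define w where "w k = (\<lambda>j. if j < k then z j else x j)" for k
  have "(x, w k) \<in> ?R\<^sup>*" if "k \<le> num_players G" for k
    using that
  proof (induction k)
    case 0
    show ?case by (simp add: w_def)
  next
    case (Suc k)
    then have k: "k < num_players G"
      by simp
    then have "z k \<in> strategies G k"
      using z by (simp add: profiles_def PiE_iff)
    with k have "(w k)(k := z k) \<in> set_pmf (logit_step G \<beta> (w k))"
      unfolding set_logit_step by blast
    moreover have "(w k)(k := z k) = w (Suc k)"
      by (simp add: w_def fun_eq_iff less_Suc_eq)
    ultimately have "(w k, w (Suc k)) \<in> ?R"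
      by simp
    moreover have "(x, w k) \<in> ?R\<^sup>*"
      using Suc k by simp
    ultimately show ?case
      by (rule rtrancl_into_rtrancl[rotated])
  qed
  \<comment> \<open>Beyond the players, \<open>w\<close> still takes the values of \<open>x\<close>;
    these agree with \<open>z\<close> because both profiles are \<open>undefined\<close>
    there.\<close>
  moreover have "w (num_players G) = z"
    using x z by (auto simp: w_def profiles_def PiE_iff extensional_def)
  ultimately show ?thesis
    by (metis order_refl)
qed

lemma logit_stationary_eqI:
  assumes "stationary_on (profiles G) (logit_step G \<beta>) p"
  shows "logit_stationary G \<beta> = p"
  unfolding logit_stationary_def
proof (rule the_equality)
  show "q = p" if "stationary_on (profiles G) (logit_step G \<beta>) q" for q
    using stationary_on_unique[OF finite_profiles that assms logit_step_irreducible] .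
qed (fact assms)

end

section \<open>Exact potential games and their Gibbs measure\<close>

locale potential_game = finite_game G \<beta>
  for G :: "'s game" and \<beta> :: real +
  fixes \<Phi> :: "(nat \<Rightarrow> 's) \<Rightarrow> real"
  assumes potential: "\<And>i x y. i < num_players G \<Longrightarrow> x \<in> profiles G \<Longrightarrow> y \<in> strategies G i \<Longrightarrow>
    utility G i (x(i := y)) - utility G i x = \<Phi> (x(i := y)) - \<Phi> x"
begin

definition partition_function :: real where
  "partition_function = (\<Sum>x\<in>profiles G. exp (\<beta> * \<Phi> x))"

definition gibbs :: "(nat \<Rightarrow> 's) pmf" where
  "gibbs = embed_pmf (\<lambda>x. if x \<in> profiles G then exp (\<beta> * \<Phi> x) / partition_function else 0)"

lemma partition_function_pos: "partition_function > 0"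
  unfolding partition_function_def
  using finite_profiles profiles_nonempty by (intro sum_pos) auto

lemma pmf_gibbs:
  "pmf gibbs x = (if x \<in> profiles G then exp (\<beta> * \<Phi> x) / partition_function else 0)"
proof -
  let ?f = "\<lambda>x. if x \<in> profiles G then exp (\<beta> * \<Phi> x) / partition_function else 0"
  have nonneg: "?f x \<ge> 0" for x
    using partition_function_pos by simp
  have "(\<integral>\<^sup>+x. ennreal (?f x) \<partial>count_space UNIV) = (\<Sum>x\<in>profiles G. ennreal (?f x))"
    using finite_profiles by (intro nn_integral_count_space') auto
  also have "\<dots> = ennreal (\<Sum>x\<in>profiles G. ?f x)"
    using nonneg by (intro sum_ennreal)
  also have "(\<Sum>x\<in>profiles G. ?f x) = (\<Sum>x\<in>profiles G. exp (\<beta> * \<Phi> x)) / partition_function"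
    by (simp add: sum_divide_distrib)
  also have "\<dots> = 1"
    using partition_function_pos by (simp flip: partition_function_def)
  finally show ?thesis
    unfolding gibbs_def using nonneg by (subst pmf_embed_pmf) auto
qed

lemma set_gibbs: "set_pmf gibbs = profiles G"
  using partition_function_pos by (auto simp: set_pmf_iff pmf_gibbs split: if_splits)

text \<open>Over the deviations of player \<open>i\<close> from \<open>x\<close>, utility and
  potential differ by a constant; its exponential \<open>c\<close> cancels between numerator and
  normaliser.\<close>

lemma logit_prob_potential:
  assumes "i < num_players G" "x \<in> profiles G" "y \<in> strategies G i"
  shows "logit_prob G \<beta> i x y =
    exp (\<beta> * \<Phi> (x(i := y))) / (\<Sum>z\<in>strategies G i. exp (\<beta> * \<Phi> (x(i := z))))"
proof -
  define c where "c = exp (\<beta> * (utility G i x - \<Phi> x))"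
  have u: "exp (\<beta> * utility G i (x(i := z))) = c * exp (\<beta> * \<Phi> (x(i := z)))"
    if "z \<in> strategies G i" for z
  proof -
    have "utility G i (x(i := z)) = (utility G i x - \<Phi> x) + \<Phi> (x(i := z))"
      using potential[OF assms(1,2) that] by simp
    then show ?thesis
      by (simp add: c_def ring_distribs flip: exp_add)
  qed
  have "c \<noteq> 0"
    by (simp add: c_def)
  with u assms(3) show ?thesis
    by (simp add: logit_prob_def flip: sum_distrib_left)
qed

text \<open>If \<open>x\<close> and \<open>z\<close> differ at most at \<open>i\<close>, each side
  is the product of both Gibbs weights over the partition function and a common logit normaliser.
  Otherwise both transition probabilities are zero.\<close>

lemma gibbs_detailed_balance:
  assumes i: "i < num_players G" and x: "x \<in> profiles G" and z: "z \<in> profiles G"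
  shows "pmf gibbs x * pmf (player_step i x) z = pmf gibbs z * pmf (player_step i z) x"
proof -
  have xz: "x i \<in> strategies G i" "z i \<in> strategies G i"
    using i x z by (auto simp: profiles_def)
  show ?thesis
  proof (cases "z = x(i := z i)")
    case True
    \<comment> \<open>Player \<open>i\<close> has the same deviations from \<open>z\<close> as from
      \<open>x\<close>, so the two logit normalisers coincide.\<close>
    have upd: "z(i := y) = x(i := y)" for y
      by (subst True) simp
    then have x_eq: "x = z(i := x i)"
      by simp
    have "pmf (player_step i x) z = logit_prob G \<beta> i x (z i)"
      "pmf (player_step i z) x = logit_prob G \<beta> i z (x i)"
      by (simp_all only: pmf_player_step[where z = z, OF i xz(2)] pmf_player_step[where z = x, OF i xz(1)]
          if_P[OF True] if_P[OF x_eq])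
    moreover have "\<Phi> (x(i := z i)) = \<Phi> z"
      using True by (rule arg_cong[OF sym])
    ultimately show ?thesis
      by (simp add: xz logit_prob_potential[OF i] x z upd pmf_gibbs)
  next
    case False
    then have "x \<noteq> z(i := x i)"
      by (metis fun_upd_triv fun_upd_upd)
    with False show ?thesis
      by (simp add: pmf_player_step[OF i] xz)
  qed
qed

theorem logit_stationary_eq_gibbs: "logit_stationary G \<beta> = gibbs"
proof (rule logit_stationary_eqI)
  have "stationary_on (profiles G) (player_step i) gibbs" if "i < num_players G" for i
    using that finite_profiles set_gibbs gibbs_detailed_balance profiles_upd
    by (intro stationary_on_detailed_balance) (auto simp: set_player_step)
  then show "stationary_on (profiles G) (logit_step G \<beta>) gibbs"
    unfolding logit_step_eq using players
    by (intro stationary_on_mixture) (auto simp: lessThan_empty_iff)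
qed

lemma expectation_gibbs:
  fixes f :: "(nat \<Rightarrow> 's) \<Rightarrow> real"
  shows "measure_pmf.expectation gibbs f =
    (\<Sum>x\<in>profiles G. exp (\<beta> * \<Phi> x) * f x) / partition_function"
proof -
  have "measure_pmf.expectation gibbs f = (\<Sum>x\<in>profiles G. pmf gibbs x * f x)"
    using integral_measure_pmf[OF finite_profiles, of gibbs f] by (simp add: set_gibbs)
  then show ?thesis
    by (simp add: pmf_gibbs sum_divide_distrib)
qed

end

section \<open>Expected social welfare of the OR game\<close>

theorem theorem10:
  fixes n :: nat and \<beta> :: real
  assumes "n \<ge> 1" and "\<beta> \<ge> 0"
  defines "\<alpha> \<equiv> (2 ^ n - 1) * exp (- \<beta>) / (1 + (2 ^ n - 1) * exp (- \<beta>))"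
  shows "measure_pmf.expectation (logit_stationary (OR_game n) \<beta>) (social_welfare (OR_game n))
           = - \<alpha> * real n"
proof -
  define u :: "(nat \<Rightarrow> nat) \<Rightarrow> real" where "u x = (if \<forall>j<n. x j = 0 then 0 else - 1)" for x
  let ?\<Omega> = "profiles (OR_game n)"
  have [simp]: "num_players (OR_game n) = n" "strategies (OR_game n) i = {0, 1}"
    "utility (OR_game n) i = u" for i
    by (simp_all add: OR_game_def u_def fun_eq_iff)
  \<comment> \<open>All players share the payoff \<open>u\<close>, which therefore serves as its own
    potential.\<close>
  interpret potential_game "OR_game n" \<beta> u
    using assms(1) by unfold_locales auto
  define o0 :: "nat \<Rightarrow> nat" where "o0 = (\<lambda>i\<in>{..<n}. 0)"
  have o0: "o0 \<in> ?\<Omega>" "u o0 = 0"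
    by (auto simp: o0_def profiles_def u_def)
  have u: "u x = - 1" if "x \<in> ?\<Omega> - {o0}" for x
  proof -
    \<comment> \<open>Extensionality makes \<open>o0\<close> the only profile that is zero at all
      players.\<close>
    have "x = o0" if "\<forall>j<n. x j = 0"
      using that \<open>x \<in> ?\<Omega> - {o0}\<close>
      by (auto simp: o0_def profiles_def PiE_iff extensional_def fun_eq_iff)
    with that show ?thesis
      by (auto simp: u_def)
  qed
  have card: "real (card (?\<Omega> - {o0})) = 2 ^ n - 1"
    using o0(1) by (simp add: profiles_def card_PiE numeral_2_eq_2[symmetric] of_nat_diff)
  \<comment> \<open>Both the partition function and the welfare sum depend on \<open>x\<close> only
    through \<open>u x\<close>, so this one formula evaluates both.\<close>
  have split: "(\<Sum>x\<in>?\<Omega>. f (u x)) = f 0 + (2 ^ n - 1) * f (- 1)" for f :: "real \<Rightarrow> real"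
    using u by (simp add: sum.remove[OF finite_profiles o0(1)] o0(2) card)
  have "social_welfare (OR_game n) x = n * u x" for x
    by (simp add: social_welfare_def)
  then have "measure_pmf.expectation (logit_stationary (OR_game n) \<beta>) (social_welfare (OR_game n))
      = (\<Sum>x\<in>?\<Omega>. exp (\<beta> * u x) * (n * u x)) / (\<Sum>x\<in>?\<Omega>. exp (\<beta> * u x))"
    by (simp add: logit_stationary_eq_gibbs expectation_gibbs partition_function_def)
  \<comment> \<open>The zero profile contributes nothing to the numerator and \<open>1\<close> to
    the denominator.\<close>
  also have "\<dots> = - \<alpha> * real n"
    unfolding split[of "\<lambda>v. exp (\<beta> * v)"] split[of "\<lambda>v. exp (\<beta> * v) * (n * v)"] \<alpha>_def
    by simp
  finally show ?thesis .
qed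

end
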